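(* Let a resource-layer model with capacities $C_{\mathrm{ET}}^{(W)}(N,M;F_\star)$ and $C_{\mathrm{ET}}^{(\infty)}(N,M;F_\star)$ be given, and consider a specified physical implementation satisfying the matched comparison with it (both as in the context). Let $r>0$ (slots per second), and suppose that for every $\epsilon>0$ the physical execution over every sufficiently long interval of duration $T$ seconds, for every demand and protocol realization, can be represented using at most $\lceil(r+\epsilon)T\rceil$ resource-layer activation slots. Then the achieved service of the implementation satisfies $$\underline S_{\mathrm{ET}}(N,M;F_\star)\le r\,C_{\mathrm{ET}}^{(\infty)}(N,M;F_\star).$$
   Context: Resource layer. A finite multigraph $G=(V,E)$, $|V|=N$, of link opportunities. In each activation slot each $e\in E$ is attempted once and succeeds with probability $p_e$, independently over opportunities and slots; each success supplies one elementary pair in a declared state. A random demand $\mathcal D=\{(s_i,t_i)\}$ (among $M$ active users) is announced before the first slot and held fixed; $d(s_i,t_i)$ is the physical endpoint distance. A window of $W$ slots starts empty with ideal storage; admissible strategies are adaptive LOCC protocols on the pairs supplied in the window, the class being closed under concatenation (running a $k$-slot and an $\ell$-slot strategy consecutively, discarding leftovers at the boundary, is an admissible $(k+\ell)$-slot strategy). $B_i^{(W)}$ counts outputs for session $i$ whose two-qubit state, conditioned on realized links and the classical record, has fidelity at least $F_\star$ with $|\Phi^+\rangle$. $$C_{\mathrm{ET}}^{(W)}(N,M;F_\star)=\sup_{\text{admissible}}\frac1W\,\mathbb E\Big[\sum_id(s_i,t_i)B_i^{(W)}\Big],\qquad C_{\mathrm{ET}}^{(\infty)}=\lim_{W\to\infty}C_{\mathrm{ET}}^{(W)}=\sup_{W\ge1}C_{\mathrm{ET}}^{(W)}.$$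 Physical layer. A physical implementation is a protocol running in wall-clock time. The demand is sampled once from the same law and held fixed. $B_i(T)$ is the number of pairs with fidelity at least $F_\star$ (same qualification rule) delivered for session $i$ during $T$ seconds. The achieved service is $$\underline S_{\mathrm{ET}}(N,M;F_\star)=\limsup_{T\to\infty}\frac1T\,\mathbb E\Big[\sum_id(s_i,t_i)B_i(T)\Big].$$ Matched comparison. The implementation has the same $G$, demand, $F_\star$ and distances $d$; each physical generation attempt at $e$ has the same success probability $p_e$ and the same independence assumptions, and is represented by a distinct resource-layer opportunity (a link opportunity in an activation slot), the assignment not being conditioned on an unrevealed outcome; the physical elementary pair is obtainable from the resource-layer elementary pair by local operations at its two endpoints. Under this correspondence every finite physical execution relevant to the counted outputs is reproducible by an admissible resource-layer strategy, including the joint output state and the classical record used for fidelity qualification. "Represented using at most $W$ activation slots" means that the execution over $[0,T]$ is so reproduced by an admissible strategy on a window of at most $W$ slots. *)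

theory Defs
  imports "HOL-Probability.Probability" "Graph_Theory.Digraph"
begin

section \<open>States of finitely many qubits\<close>

text \<open>
  A qubit sits in a memory register of a node, or it has been handed over to the users:
  \<open>Out j False\<close> and \<open>Out j True\<close> are the two halves of the \<open>j\<close>-th output pair (counted over all
  sessions), held by the source and by the target of its session.

  The computational basis vector in which exactly the qubits of \<open>A\<close> have value 1 is represented
  by the set \<open>A\<close> itself, so an operator on the qubits \<open>Q\<close> is a matrix indexed by \<open>Pow Q\<close>, and a
  linear map from the qubits \<open>L\<close> to the qubits \<open>L'\<close> is a matrix with rows \<open>Pow L'\<close> and columns
  \<open>Pow L\<close>. Entries outside these index sets are irrelevant.
\<close>

datatype 'v qubit = Mem 'v nat | Out nat bool

type_synonym 'v matrix = "'v qubit set \<Rightarrow> 'v qubit set \<Rightarrow> complex"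

type_synonym pair_op = "bool \<times> bool \<Rightarrow> bool \<times> bool \<Rightarrow> complex"

definition registers :: "'v \<Rightarrow> 'v qubit set" where
  "registers v = range (Mem v)"

definition pair_density :: "pair_op \<Rightarrow> bool" where
  "pair_density \<sigma> \<longleftrightarrow>
     (\<forall>\<psi>. (\<Sum>a\<in>UNIV. \<Sum>b\<in>UNIV. cnj (\<psi> a) * \<sigma> a b * \<psi> b) \<in> \<real>\<^sub>\<ge>\<^sub>0) \<and> (\<Sum>a\<in>UNIV. \<sigma> a a) = 1"

definition Phi_plus :: "bool \<times> bool \<Rightarrow> complex" where
  "Phi_plus a = (if fst a = snd a then 1 / sqrt 2 else 0)"

text \<open>Fidelity with a pure state, in the convention \<open>\<langle>\<phi>|\<rho>|\<phi>\<rangle>\<close>.\<close>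

definition fidelity :: "pair_op \<Rightarrow> (bool \<times> bool \<Rightarrow> complex) \<Rightarrow> real" where
  "fidelity \<rho> \<phi> = Re (\<Sum>a\<in>UNIV. \<Sum>b\<in>UNIV. cnj (\<phi> a) * \<rho> a b * \<phi> b)"

text \<open>
  \<open>outs x ! j\<close> is the session of the \<open>j\<close>-th output pair. The state is that of the qubits
  \<open>held x \<union> outputs x\<close>, and it is not normalized: its trace is the probability of the branch in
  which the configuration is reached.
\<close>

record 'v config =
  held :: "'v qubit set"
  outs :: "nat list"
  state :: "'v matrix"

definition outputs :: "'v config \<Rightarrow> 'v qubit set" where
  "outputs x = {Out j b |j b. j < length (outs x)}"

definition empty_config :: "'v config" where
  "empty_config = \<lparr>held = {}, outs = [], state = (\<lambda>A B. if A = {} \<and> B = {} then 1 else 0)\<rparr>"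

definition prob :: "'v config \<Rightarrow> ennreal" where
  "prob x = ennreal (Re (\<Sum>A\<in>Pow (held x \<union> outputs x). state x A A))"

text \<open>All nodes discard their registers (partial trace); outputs are kept.\<close>

definition discard :: "'v config \<Rightarrow> 'v config" where
  "discard x = x\<lparr>held := {}, state := (\<lambda>A B. \<Sum>C\<in>Pow (held x). state x (A \<union> C) (B \<union> C))\<rparr>"

text \<open>Joint state of all outputs, conditioned on the branch.\<close>

definition output_state :: "'v config \<Rightarrow> 'v matrix" where
  "output_state x A B =
     state (discard x) A B / (\<Sum>C\<in>Pow (outputs x). state (discard x) C C)"

definition output_pair :: "'v config \<Rightarrow> nat \<Rightarrow> pair_op" where
  "output_pair x j = (\<lambda>a b.
     let enc = (\<lambda>a. (if fst a then {Out j False} else {}) \<union> (if snd a then {Out j True} else {}))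
     in \<Sum>C\<in>Pow (outputs x - {Out j False, Out j True}). output_state x (enc a \<union> C) (enc b \<union> C))"

section \<open>Operations\<close>

text \<open>
  An instrument lists, for each announced classical outcome, the set of qubits present afterwards
  and the Kraus operators whose (unrecorded) sum describes that outcome. It acts on the qubits
  \<open>L\<close> and creates and removes qubits as needed.
\<close>

type_synonym 'v instrument = "('v qubit set \<times> 'v matrix list) list"

definition instrument :: "'v qubit set \<Rightarrow> 'v qubit set \<Rightarrow> 'v instrument \<Rightarrow> bool" where
  "instrument L allowed ins \<longleftrightarrow>
     (\<forall>(L', Ks) \<in> set ins. finite L' \<and> L' \<subseteq> allowed) \<and>
     (\<forall>C\<in>Pow L. \<forall>D\<in>Pow L.
        (\<Sum>(L', Ks)\<leftarrow>ins. \<Sum>K\<leftarrow>Ks. \<Sum>A\<in>Pow L'. cnj (K A C) * K A D) = (if C = D then 1 else 0))"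

definition apply_outcome ::
    "'v qubit set \<Rightarrow> 'v qubit set \<times> 'v matrix list \<Rightarrow> 'v config \<Rightarrow> 'v config" where
  "apply_outcome L = (\<lambda>(L', Ks) x. x\<lparr>
     held := (held x - L) \<union> L',
     state := (\<lambda>A B. \<Sum>K\<leftarrow>Ks. \<Sum>C\<in>Pow L. \<Sum>D\<in>Pow L.
        K (A \<inter> L') C * state x ((A - L') \<union> C) ((B - L') \<union> D) * cnj (K (B \<inter> L') D))\<rparr>)"

text \<open>
  The two halves of a pair supplied by a link are stored in registers of its two endpoints with
  the addresses \<open>addr e\<close>. The first half of an elementary state belongs to the tail.
\<close>

definition half :: "('v, 'e) pre_digraph \<Rightarrow> ('e \<Rightarrow> nat \<times> nat) \<Rightarrow> 'e \<Rightarrow> bool \<Rightarrow> 'v qubit" where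
  "half G addr e b =
     (if b then Mem (head G e) (snd (addr e)) else Mem (tail G e) (fst (addr e)))"

definition free_addresses ::
    "('v, 'e) pre_digraph \<Rightarrow> ('e \<Rightarrow> nat \<times> nat) \<Rightarrow> 'e set \<Rightarrow> 'v config \<Rightarrow> bool" where
  "free_addresses G addr S x \<longleftrightarrow>
     inj_on (\<lambda>(e, b). half G addr e b) (S \<times> UNIV) \<and>
     (\<forall>e\<in>S. \<forall>b. half G addr e b \<notin> held x)"

text \<open>Independent generation attempts at the links in \<open>S\<close>, of which exactly those in \<open>R\<close> succeed.\<close>

definition attempt ::
    "('v, 'e) pre_digraph \<Rightarrow> ('e \<Rightarrow> real) \<Rightarrow> ('e \<Rightarrow> pair_op) \<Rightarrow> ('e \<Rightarrow> nat \<times> nat) \<Rightarrow>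
     'e set \<Rightarrow> 'e set \<Rightarrow> 'v config \<Rightarrow> 'v config" where
  "attempt G p \<sigma> addr S R x =
     (let new = {half G addr e b |e b. e \<in> R};
          vals = (\<lambda>A e. (half G addr e False \<in> A, half G addr e True \<in> A))
      in x\<lparr>held := held x \<union> new,
           state := (\<lambda>A B. of_real ((\<Prod>e\<in>R. p e) * (\<Prod>e\<in>S - R. 1 - p e)) *
             state x (A - new) (B - new) * (\<Prod>e\<in>R. \<sigma> e (vals A e) (vals B e)))\<rparr>)"

text \<open>The registers \<open>a\<close> and \<open>b\<close> are handed over as an output of session \<open>i\<close>.\<close>

definition deliver :: "nat \<Rightarrow> 'v qubit \<Rightarrow> 'v qubit \<Rightarrow> 'v config \<Rightarrow> 'v config" where
  "deliver i a b x =
     (let n = length (outs x); back = id(Out n False := a, Out n True := b)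
      in x\<lparr>held := held x - {a, b}, outs := outs x @ [i],
           state := (\<lambda>A B. state x (back ` A) (back ` B))\<rparr>)"

text \<open>The endpoint pairs of the sessions; the index of a session is its position in the list.\<close>

type_synonym 'v demand = "('v \<times> 'v) list"

definition deliverable :: "'v demand \<Rightarrow> nat \<Rightarrow> nat \<Rightarrow> nat \<Rightarrow> 'v config \<Rightarrow> bool" where
  "deliverable D i k l x \<longleftrightarrow> i < length D \<and>
     Mem (fst (D ! i)) k \<in> held x \<and> Mem (snd (D ! i)) l \<in> held x \<and>
     Mem (fst (D ! i)) k \<noteq> Mem (snd (D ! i)) l"

section \<open>Resource layer\<close>

datatype 'e event = Links "'e set" | Outcome nat | Silent

datatype ('v, 'e) action =
    Activate "'e \<Rightarrow> nat \<times> nat"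
  | Local 'v "'v instrument"
  | Deliver nat nat nat
  | Discard

text \<open>
  An adaptive protocol, as a finite-depth tree: the next action may depend on everything recorded
  so far. All outcomes are announced to all nodes. Registers not acted upon do not change (ideal
  storage).
\<close>

datatype ('v, 'e) strategy =
    Halt
  | Do "('v, 'e) action" "'e event \<Rightarrow> ('v, 'e) strategy"

record ('v, 'e) resource =
  graph :: "('v, 'e) pre_digraph"
  success :: "'e \<Rightarrow> real"
  elementary :: "'e \<Rightarrow> pair_op"
  law :: "'v demand pmf"
  active_users :: nat
  distance :: "'v \<Rightarrow> 'v \<Rightarrow> real"
  threshold :: real
  admissible :: "nat \<Rightarrow> ('v demand \<Rightarrow> ('v, 'e) strategy) set"

fun valid_action ::
    "('v, 'e) resource \<Rightarrow> 'v demand \<Rightarrow> ('v, 'e) action \<Rightarrow> 'v config \<Rightarrow> bool" where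
  "valid_action M D (Activate addr) x = free_addresses (graph M) addr (arcs (graph M)) x"
| "valid_action M D (Local v ins) x =
     (v \<in> verts (graph M) \<and> instrument (held x \<inter> registers v) (registers v) ins)"
| "valid_action M D (Deliver i k l) x = deliverable D i k l x"
| "valid_action M D Discard x = True"

fun outcomes ::
    "('v, 'e) resource \<Rightarrow> 'v demand \<Rightarrow> ('v, 'e) action \<Rightarrow> 'v config \<Rightarrow> ('e event \<times> 'v config) set"
where
  "outcomes M D (Activate addr) x =
     {(Links R, attempt (graph M) (success M) (elementary M) addr (arcs (graph M)) R x) |R.
        R \<subseteq> arcs (graph M)}"
| "outcomes M D (Local v ins) x =
     {(Outcome j, apply_outcome (held x \<inter> registers v) (ins ! j) x) |j. j < length ins}"
| "outcomes M D (Deliver i k l) x =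
     {(Silent, deliver i (Mem (fst (D ! i)) k) (Mem (snd (D ! i)) l) x)}"
| "outcomes M D Discard x = {(Silent, discard x)}"

text \<open>The final branches of a protocol, each with its classical record.\<close>

primrec run ::
    "('v, 'e) resource \<Rightarrow> 'v demand \<Rightarrow> ('v, 'e) strategy \<Rightarrow> 'v config \<Rightarrow>
     ('e event list \<times> 'v config) set" where
  "run M D Halt x = {([], x)}"
| "run M D (Do a k) x = {(oc # c, z) |oc y c z. (oc, y) \<in> outcomes M D a x \<and> (c, z) \<in> run M D (k oc) y}"

text \<open>LOCC protocols that use exactly \<open>W\<close> activation slots.\<close>

primrec locc ::
    "('v, 'e) resource \<Rightarrow> 'v demand \<Rightarrow> ('v, 'e) strategy \<Rightarrow> nat \<Rightarrow> 'v config \<Rightarrow> bool" where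
  "locc M D Halt W x \<longleftrightarrow> W = 0"
| "locc M D (Do a k) W x \<longleftrightarrow> valid_action M D a x \<and>
     (case a of
        Activate _ \<Rightarrow> W > 0 \<and> (\<forall>(oc, y) \<in> outcomes M D a x. locc M D (k oc) (W - 1) y)
      | _ \<Rightarrow> (\<forall>(oc, y) \<in> outcomes M D a x. locc M D (k oc) W y))"

primrec concatenate :: "('v, 'e) strategy \<Rightarrow> ('v, 'e) strategy \<Rightarrow> ('v, 'e) strategy" where
  "concatenate Halt t = Do Discard (\<lambda>_. t)"
| "concatenate (Do a k) t = Do a (\<lambda>oc. concatenate (k oc) t)"

definition resource_model :: "('v, 'e) resource \<Rightarrow> bool" where
  "resource_model M \<longleftrightarrow>
     fin_digraph (graph M) \<and>
     (\<forall>e\<in>arcs (graph M). 0 \<le> success M e \<and> success M e \<le> 1 \<and> pair_density (elementary M e)) \<and>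
     (\<forall>D\<in>set_pmf (law M). \<exists>U\<subseteq>verts (graph M).
        card U = active_users M \<and> set D \<subseteq> U \<times> U) \<and>
     (\<forall>u\<in>verts (graph M). \<forall>v\<in>verts (graph M). 0 \<le> distance M u v) \<and>
     (\<forall>W\<ge>1. admissible M W \<noteq> {}) \<and>
     (\<forall>W\<ge>1. \<forall>\<sigma>\<in>admissible M W. \<forall>D\<in>set_pmf (law M). locc M D (\<sigma> D) W empty_config) \<and>
     (\<forall>k\<ge>1. \<forall>l\<ge>1. \<forall>\<sigma>\<in>admissible M k. \<forall>\<tau>\<in>admissible M l.
        (\<lambda>D. concatenate (\<sigma> D) (\<tau> D)) \<in> admissible M (k + l))"

definition qualified_outputs :: "('v, 'e) resource \<Rightarrow> 'v config \<Rightarrow> nat \<Rightarrow> nat" where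
  "qualified_outputs M x i = card {j. j < length (outs x) \<and> outs x ! j = i \<and>
     threshold M \<le> fidelity (output_pair x j) Phi_plus}"

definition service :: "('v, 'e) resource \<Rightarrow> 'v demand \<Rightarrow> 'v config \<Rightarrow> real" where
  "service M D x = (\<Sum>i<length D. distance M (fst (D ! i)) (snd (D ! i)) * real (qualified_outputs M x i))"

definition expected_service ::
    "('v, 'e) resource \<Rightarrow> 'v demand \<Rightarrow> ('r \<times> 'v config) set \<Rightarrow> ennreal" where
  "expected_service M D X = (\<integral>\<^sup>+ (c, x). prob x * ennreal (service M D x) \<partial>count_space X)"

definition capacity :: "('v, 'e) resource \<Rightarrow> nat \<Rightarrow> ennreal" where
  "capacity M W = (SUP \<sigma>\<in>admissible M W.
     (\<integral>\<^sup>+ D. expected_service M D (run M D (\<sigma> D) empty_config) \<partial>measure_pmf (law M)) / of_nat W)"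

text \<open>Closure under concatenation makes the supremum also the limit.\<close>

definition capacity_inf :: "('v, 'e) resource \<Rightarrow> ennreal" where
  "capacity_inf M = (SUP W\<in>{1..}. capacity M W)"

section \<open>Physical layer\<close>

datatype 'e phys_event = Attempted 'e bool | Measured nat | Delivered

text \<open>
  Between attempts and handovers the held qubits undergo arbitrary, not necessarily local,
  quantum operations; this covers control, storage noise and readout.
\<close>

datatype ('v, 'e) phys_action =
    Attempt 'e nat nat
  | Evolve "'v instrument"
  | Handover nat nat nat

text \<open>
  The controller maps the demand and the classical record so far to the time (in seconds) and the
  kind of the next event, if there is one.
\<close>

record ('v, 'e) physical =
  phys_success :: "'e \<Rightarrow> real"
  phys_elementary :: "'e \<Rightarrow> pair_op"
  controller :: "'v demand \<Rightarrow> 'e phys_event list \<Rightarrow> (real \<times> ('v, 'e) phys_action) option"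

fun valid_phys_action ::
    "('v, 'e) resource \<Rightarrow> 'v demand \<Rightarrow> ('v, 'e) phys_action \<Rightarrow> 'v config \<Rightarrow> bool" where
  "valid_phys_action M D (Attempt e k l) x =
     (e \<in> arcs (graph M) \<and> free_addresses (graph M) (\<lambda>_. (k, l)) {e} x)"
| "valid_phys_action M D (Evolve ins) x =
     instrument (held x) (\<Union>v\<in>verts (graph M). registers v) ins"
| "valid_phys_action M D (Handover i k l) x = deliverable D i k l x"

fun phys_outcomes ::
    "('v, 'e) resource \<Rightarrow> ('v, 'e) physical \<Rightarrow> 'v demand \<Rightarrow> ('v, 'e) phys_action \<Rightarrow> 'v config \<Rightarrow>
     ('e phys_event \<times> 'v config) set" where
  "phys_outcomes M P D (Attempt e k l) x =
     {(Attempted e b, attempt (graph M) (phys_success P) (phys_elementary P) (\<lambda>_. (k, l)) {e}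
        (if b then {e} else {}) x) |b. True}"
| "phys_outcomes M P D (Evolve ins) x =
     {(Measured j, apply_outcome (held x) (ins ! j) x) |j. j < length ins}"
| "phys_outcomes M P D (Handover i k l) x =
     {(Delivered, deliver i (Mem (fst (D ! i)) k) (Mem (snd (D ! i)) l) x)}"

inductive_set reachable ::
    "('v, 'e) resource \<Rightarrow> ('v, 'e) physical \<Rightarrow> 'v demand \<Rightarrow> real \<Rightarrow>
     ('e phys_event list \<times> 'v config) set"
  for M P D T where
  start: "([], empty_config) \<in> reachable M P D T"
| step: "(h, x) \<in> reachable M P D T \<Longrightarrow> controller P D h = Some (t, a) \<Longrightarrow> t \<le> T \<Longrightarrow>
    (oc, y) \<in> phys_outcomes M P D a x \<Longrightarrow> (h @ [oc], y) \<in> reachable M P D T"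

text \<open>The branches of the execution over \<open>[0, T]\<close>, each with its classical record.\<close>

definition execution ::
    "('v, 'e) resource \<Rightarrow> ('v, 'e) physical \<Rightarrow> 'v demand \<Rightarrow> real \<Rightarrow>
     ('e phys_event list \<times> 'v config) set" where
  "execution M P D T =
     {(h, x) \<in> reachable M P D T. \<forall>t a. controller P D h = Some (t, a) \<longrightarrow> t > T}"

text \<open>The last condition says that only finitely many events happen in finite time.\<close>

definition physical_implementation ::
    "('v, 'e) resource \<Rightarrow> ('v, 'e) physical \<Rightarrow> bool" where
  "physical_implementation M P \<longleftrightarrow>
     (\<forall>e\<in>arcs (graph M). 0 \<le> phys_success P e \<and> phys_success P e \<le> 1 \<and>
        pair_density (phys_elementary P e)) \<and>
     (\<forall>D\<in>set_pmf (law M). \<forall>T. \<forall>(h, x)\<in>reachable M P D T. \<forall>t a.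
        controller P D h = Some (t, a) \<longrightarrow> 0 \<le> t \<and> valid_phys_action M D a x \<and>
        (\<forall>(oc, y)\<in>phys_outcomes M P D a x. \<forall>t' a'.
           controller P D (h @ [oc]) = Some (t', a') \<longrightarrow> t \<le> t')) \<and>
     (\<forall>D\<in>set_pmf (law M). \<forall>T. \<exists>n. \<forall>(h, x)\<in>reachable M P D T. length h \<le> n)"

definition achieved_service :: "('v, 'e) resource \<Rightarrow> ('v, 'e) physical \<Rightarrow> ennreal" where
  "achieved_service M P = Limsup at_top (\<lambda>T::real.
     (\<integral>\<^sup>+ D. expected_service M D (execution M P D T) \<partial>measure_pmf (law M)) / ennreal T)"

section \<open>Matched comparison\<close>

definition qubit_channel :: "(bool \<Rightarrow> bool \<Rightarrow> complex) list \<Rightarrow> bool" where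
  "qubit_channel Ks \<longleftrightarrow>
     (\<forall>c d. (\<Sum>K\<leftarrow>Ks. \<Sum>a\<in>UNIV. cnj (K a c) * K a d) = (if c = d then 1 else 0))"

definition locally_obtainable :: "pair_op \<Rightarrow> pair_op \<Rightarrow> bool" where
  "locally_obtainable \<tau> \<sigma> \<longleftrightarrow> (\<exists>Ks Ls. qubit_channel Ks \<and> qubit_channel Ls \<and>
     (\<forall>a b a' b'. \<tau> (a, b) (a', b') = (\<Sum>K\<leftarrow>Ks. \<Sum>L\<leftarrow>Ls. \<Sum>c\<in>UNIV. \<Sum>d\<in>UNIV. \<Sum>c'\<in>UNIV. \<Sum>d'\<in>UNIV.
        K a c * L b d * \<sigma> (c, d) (c', d') * cnj (K a' c') * cnj (L b' d'))))"

text \<open>The set of links realized in each activation slot.\<close>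

definition slot_links :: "'e event list \<Rightarrow> 'e set list" where
  "slot_links c = [R. Links R \<leftarrow> c]"

text \<open>
  The \<open>W\<close>-slot strategy \<open>s\<close> reproduces the execution \<open>X\<close>: \<open>\<pi>\<close> sends each resource-layer record to
  the physical record it simulates, and the attempt at \<open>e\<close> that follows the physical record \<open>h\<close>
  is represented by the opportunity \<open>e\<close> of slot \<open>\<alpha> h\<close>. As \<open>\<alpha>\<close> sees only the record before the
  attempt, the assignment does not depend on outcomes not yet revealed. The physical record
  determines what counts as qualified, so the conditional joint output state has to agree on
  every branch and not only on average.
\<close>

definition reproduces ::
    "('v, 'e) resource \<Rightarrow> 'v demand \<Rightarrow> nat \<Rightarrow> ('v, 'e) strategy \<Rightarrow>
     ('e phys_event list \<times> 'v config) set \<Rightarrow> bool" where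
  "reproduces M D W s X \<longleftrightarrow> (\<exists>(\<pi> :: 'e event list \<Rightarrow> 'e phys_event list) (\<alpha> :: 'e phys_event list \<Rightarrow> nat).
     (\<forall>(h, x)\<in>X. prob x > 0 \<longrightarrow>
        (\<forall>m<length h. \<forall>e b. h ! m = Attempted e b \<longrightarrow> \<alpha> (take m h) < W \<and>
           (\<forall>m'<m. \<forall>b'. h ! m' = Attempted e b' \<longrightarrow> \<alpha> (take m' h) \<noteq> \<alpha> (take m h)))) \<and>
     (\<forall>(c, y)\<in>run M D s empty_config. prob y > 0 \<longrightarrow>
        (\<exists>x. (\<pi> c, x) \<in> X \<and> outs y = outs x \<and>
           (\<forall>A\<in>Pow (outputs x). \<forall>B\<in>Pow (outputs x). output_state y A B = output_state x A B)) \<and>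
        (\<forall>m<length (\<pi> c). \<forall>e b. \<pi> c ! m = Attempted e b \<longrightarrow>
           (b \<longleftrightarrow> e \<in> slot_links c ! \<alpha> (take m (\<pi> c))))) \<and>
     (\<forall>(h, x)\<in>X. prob x =
        (\<integral>\<^sup>+ (c, y). prob y \<partial>count_space {(c, y) \<in> run M D s empty_config. \<pi> c = h})))"

definition representable ::
    "('v, 'e) resource \<Rightarrow> ('v, 'e) physical \<Rightarrow> real \<Rightarrow> nat \<Rightarrow> bool" where
  "representable M P T W \<longleftrightarrow> (\<exists>W'. 1 \<le> W' \<and> W' \<le> W \<and> (\<exists>\<sigma>\<in>admissible M W'.
     \<forall>D\<in>set_pmf (law M). reproduces M D W' (\<sigma> D) (execution M P D T)))"

text \<open>
  Graph, demand law, distances and threshold are shared by construction, and the independence of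
  physical attempts is built into \<^const>\<open>attempt\<close>.
\<close>

definition matched :: "('v, 'e) resource \<Rightarrow> ('v, 'e) physical \<Rightarrow> bool" where
  "matched M P \<longleftrightarrow>
     (\<forall>e\<in>arcs (graph M). phys_success P e = success M e \<and>
        locally_obtainable (phys_elementary P e) (elementary M e)) \<and>
     (\<forall>T\<ge>0. \<exists>W. representable M P T W)"

end

theory Submission
  imports Defs
begin

text \<open>
  On every branch a reproducing strategy shows the same conditional output state as the physical
  execution it simulates, hence the same service, and it distributes the probability of each
  physical record over the resource-layer records that simulate it. Thus it serves in the window
  at least what the execution serves on average, that is, at most
  \<open>\<lceil>(r + \<epsilon>) T\<rceil> C\<^sub>\<infinity>\<close>. Divide by \<open>T\<close>, let \<open>T \<rightarrow> \<infinity>\<close>, and then \<open>\<epsilon> \<rightarrow> 0\<close>.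
\<close>

text \<open>The controller sees only the demand and the record, and the label of each outcome
  singles out its branch, so replaying a record replays the configuration. Hence a resource-layer
  record simulates at most one physical branch.\<close>

lemma reachable_record_determines_config:
  assumes "(h, x) \<in> reachable M P D T" and "(h, x') \<in> reachable M P D T"
  shows "x = x'"
  using assms
proof (induction arbitrary: x' rule: reachable.induct)
  case start
  then show ?case by (cases rule: reachable.cases) auto
next
  case (step h x t a oc y)
  from step.prems obtain z t' a' where z: "(h, z) \<in> reachable M P D T"
      "controller P D h = Some (t', a')" "(oc, x') \<in> phys_outcomes M P D a' z"
    by (cases rule: reachable.cases) auto
  then have "z = x" "a' = a" using step by auto
  with z step.hyps show ?case by (cases a) auto
qed

text \<open>The tree has finite depth and each action has finitely many outcomes. This turns the
  resource-layer expectation into a finite sum, which can be exchanged with the integral over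
  physical branches.\<close>

lemma finite_run:
  assumes "finite (arcs (graph M))"
  shows "finite (run M D s x)"
proof (induction s arbitrary: x)
  case Halt
  then show ?case by simp
next
  case (Do a k)
  have fin: "finite (outcomes M D a x)" using assms by (cases a) auto
  have "run M D (Do a k) x =
      (\<Union>(oc, y)\<in>outcomes M D a x. (\<lambda>(c, z). (oc # c, z)) ` run M D (k oc) y)"
    by (auto simp: image_iff)
  moreover have "finite (run M D (k oc) y)" for oc y using Do by simp
  ultimately show ?case using fin by auto
qed

lemma service_cong:
  assumes outs: "outs y = outs x"
    and eq: "\<And>A B. A \<subseteq> outputs x \<Longrightarrow> B \<subseteq> outputs x \<Longrightarrow> output_state y A B = output_state x A B"
  shows "service M D y = service M D x"
proof -
  have o: "outputs y = outputs x" using outs by (simp add: outputs_def)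
  have "output_pair y j = output_pair x j" if "j < length (outs x)" for j
  proof -
    \<comment> \<open>Both halves of pair \<open>j\<close> are outputs, so every index at which
      \<open>output_pair\<close> reads the state is a subset of \<open>outputs x\<close>, where
      agreement is assumed.\<close>
    have "Out j b \<in> outputs x" for b using that by (auto simp: outputs_def)
    then show ?thesis
      unfolding output_pair_def Let_def o
      by (intro ext sum.cong refl eq) (auto split: if_splits)
  qed
  then have "qualified_outputs M y i = qualified_outputs M x i" for i
    unfolding qualified_outputs_def outs by (intro arg_cong[where f = card]) auto
  then show ?thesis by (simp add: service_def)
qed

text \<open>Double counting: the term of a physical branch is split over the fibre of
  \<open>\<pi>\<close> above its record, and after exchanging the summations each resource branch
  contributes its own service to at most one physical branch.\<close>

lemma expected_service_reproduces_le:
  fixes M :: "('v, 'e) resource"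
  assumes fin: "finite (arcs (graph M))"
    and rep: "reproduces M D W s (execution M P D T)"
  shows "expected_service M D (execution M P D T) \<le> expected_service M D (run M D s empty_config)"
proof -
  define X where "X = execution M P D T"
  define R where "R = run M D s empty_config"
  have finR: "finite R" unfolding R_def by (rule finite_run[OF fin])
  have functional: "x = x'" if "(h, x) \<in> X" "(h, x') \<in> X" for h x x'
    using that reachable_record_determines_config unfolding X_def execution_def by blast
  obtain \<pi> where
    \<pi>: "\<forall>(c, y)\<in>R. prob y > 0 \<longrightarrow> (\<exists>x. (\<pi> c, x) \<in> X \<and> outs y = outs x \<and>
           (\<forall>A\<in>Pow (outputs x). \<forall>B\<in>Pow (outputs x). output_state y A B = output_state x A B))"
      "\<forall>(h, x)\<in>X. prob x = (\<integral>\<^sup>+ (c, y). prob y \<partial>count_space {(c, y) \<in> R. \<pi> c = h})"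
    using rep unfolding reproduces_def X_def[symmetric] R_def[symmetric]
    by (elim exE conjE) (rule that; fast)
  have sim: "\<exists>x. (\<pi> c, x) \<in> X \<and> outs y = outs x \<and>
      (\<forall>A\<in>Pow (outputs x). \<forall>B\<in>Pow (outputs x). output_state y A B = output_state x A B)"
    if "(c, y) \<in> R" "prob y > 0" for c y
    using \<pi>(1) that by fast
  have prob: "prob x = (\<integral>\<^sup>+ (c, y). prob y \<partial>count_space {(c, y) \<in> R. \<pi> c = h})"
    if "(h, x) \<in> X" for h x
    using bspec[OF \<pi>(2) that] by (simp only: prod.case)
  \<comment> \<open>The share of the resource branch \<open>(c, y)\<close> in the term of the
    physical branch \<open>(h, x)\<close>.\<close>
  define f where "f = (\<lambda>(h, x) (c, y :: 'v config). if \<pi> c = h then prob y * ennreal (service M D x) else 0)"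
  \<comment> \<open>Summing over all of \<open>R\<close> with zeros off the fibre makes the index
    set independent of \<open>h\<close>, as the exchange below requires.\<close>
  have fiber: "prob x = (\<Sum>(c, y)\<in>R. if \<pi> c = h then prob y else 0)" if "(h, x) \<in> X" for h x
  proof -
    have "prob x = (\<Sum>(c, y)\<in>{(c, y) \<in> R. \<pi> c = h}. prob y)"
      unfolding prob[OF that]
      by (rule nn_integral_count_space_finite) (auto intro: finite_subset[OF _ finR])
    also have "\<dots> = (\<Sum>(c, y)\<in>R. if \<pi> c = h then prob y else 0)"
      by (rule sum.mono_neutral_cong_left[OF finR]) (auto split: if_splits)
    finally show ?thesis .
  qed
  have "(case hx of (h, x) \<Rightarrow> prob x * ennreal (service M D x)) = (\<Sum>cy\<in>R. f hx cy)"
    if "hx \<in> X" for hx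
  proof (cases hx)
    case (Pair h x)
    have "prob x * ennreal (service M D x) = (\<Sum>cy\<in>R. f (h, x) cy)"
      using that Pair by (subst fiber)
        (auto simp: f_def sum_distrib_right intro!: sum.cong)
    then show ?thesis using Pair by simp
  qed
  then have "expected_service M D X = (\<integral>\<^sup>+ hx. (\<Sum>cy\<in>R. f hx cy) \<partial>count_space X)"
    unfolding expected_service_def by (intro nn_integral_cong) simp
  also have "\<dots> = (\<Sum>cy\<in>R. \<integral>\<^sup>+ hx. f hx cy \<partial>count_space X)"
    by (rule nn_integral_sum) simp
  also have "\<dots> \<le> (\<Sum>(c, y)\<in>R. prob y * ennreal (service M D y))"
  proof (rule sum_mono)
    fix cy assume cy: "cy \<in> R"
    obtain c y where [simp]: "cy = (c, y)" by fastforce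
    show "(\<integral>\<^sup>+ hx. f hx cy \<partial>count_space X) \<le> (case cy of (c, y) \<Rightarrow> prob y * ennreal (service M D y))"
    proof (cases "prob y > 0")
      \<comment> \<open>A simulated physical branch is guaranteed only for
        \<open>prob y > 0\<close>; otherwise the weight is 0.\<close>
      case False
      then have "f hx cy = 0" for hx by (auto simp: f_def split: prod.splits)
      then show ?thesis by simp
    next
      case True
      then obtain x where x: "(\<pi> c, x) \<in> X" and outs: "outs y = outs x"
        and st: "\<forall>A\<in>Pow (outputs x). \<forall>B\<in>Pow (outputs x). output_state y A B = output_state x A B"
        using sim[of c y] cy by (simp only: \<open>cy = (c, y)\<close>) blast
      have sv: "service M D y = service M D x" by (rule service_cong[OF outs]) (use st in auto)
      \<comment> \<open>By \<open>functional\<close>, \<open>(\<pi> c, x)\<close> is the only branch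
        in \<open>X\<close> with record \<open>\<pi> c\<close>, so the integrand is supported at one
        point.\<close>
      have "f hx cy \<le> prob y * ennreal (service M D y) * indicator {(\<pi> c, x)} hx"
        if "hx \<in> X" for hx
        using that functional[OF x] by (auto simp: f_def sv split: prod.splits)
      then have "(\<integral>\<^sup>+ hx. f hx cy \<partial>count_space X) \<le>
          (\<integral>\<^sup>+ hx. prob y * ennreal (service M D y) * indicator {(\<pi> c, x)} hx \<partial>count_space X)"
        by (intro nn_integral_mono) simp
      also have "\<dots> = prob y * ennreal (service M D y)"
        using x by (subst nn_integral_cmult_indicator) auto
      finally show ?thesis by simp
    qed
  qed
  also have "\<dots> = expected_service M D R"
    unfolding expected_service_def by (rule nn_integral_count_space_finite[OF finR, symmetric])
  finally show ?thesis unfolding X_def R_def .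
qed

text \<open>As a supremum, \<open>capacity_inf\<close> bounds the rate of every window, short ones
  included; a window of \<open>W'\<close> slots therefore serves at most \<open>W'\<close> times as
  much, and \<open>W' \<le> W\<close>.\<close>

lemma expected_service_representable_le:
  assumes fin: "finite (arcs (graph M))" and rep: "representable M P T W"
  shows "(\<integral>\<^sup>+ D. expected_service M D (execution M P D T) \<partial>measure_pmf (law M))
    \<le> of_nat W * capacity_inf M"
proof -
  obtain W' \<sigma> where W': "1 \<le> W'" "W' \<le> W" and \<sigma>: "\<sigma> \<in> admissible M W'"
    and repr: "\<And>D. D \<in> set_pmf (law M) \<Longrightarrow> reproduces M D W' (\<sigma> D) (execution M P D T)"
    using rep unfolding representable_def by blast
  define I where "I = (\<integral>\<^sup>+ D. expected_service M D (run M D (\<sigma> D) empty_config) \<partial>measure_pmf (law M))"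
  have "(\<integral>\<^sup>+ D. expected_service M D (execution M P D T) \<partial>measure_pmf (law M)) \<le> I"
    unfolding I_def using expected_service_reproduces_le[OF fin repr]
    by (intro nn_integral_mono_AE) (simp add: AE_measure_pmf_iff)
  also have "I = of_nat W' * (I / of_nat W')"
    using W' by (simp add: ennreal_times_divide ennreal_mult_divide_eq mult.commute)
  also have "I / of_nat W' \<le> capacity M W'"
    unfolding I_def capacity_def by (rule SUP_upper[OF \<sigma>])
  also have "capacity M W' \<le> capacity_inf M"
    unfolding capacity_inf_def using W' by (intro SUP_upper) auto
  also have "of_nat W' \<le> (of_nat W :: ennreal)" using W' by simp
  finally show ?thesis by (simp add: mult_left_mono mult_right_mono)
qed

theorem mainTheorem9:
  fixes M :: "('v, 'e) resource" and P :: "('v, 'e) physical" and r :: real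
  assumes "resource_model M"
    and "physical_implementation M P"
    and "matched M P"
    and "r > 0"
    and "\<And>\<epsilon>::real. \<epsilon> > 0 \<Longrightarrow> \<exists>T\<^sub>0. \<forall>T\<ge>T\<^sub>0. representable M P T (nat \<lceil>(r + \<epsilon>) * T\<rceil>)"
  shows "achieved_service M P \<le> ennreal r * capacity_inf M"
proof -
  have fin: "finite (arcs (graph M))"
    using assms(1) unfolding resource_model_def by (elim conjE) (rule fin_digraph.finite_arcs)
  \<comment> \<open>One \<open>\<epsilon>\<close> is the excess slot rate of the hypothesis, the
    other pays for rounding up to whole slots.\<close>
  have bound: "achieved_service M P \<le> ennreal (r + 2 * \<epsilon>) * capacity_inf M" if "\<epsilon> > 0" for \<epsilon> :: real
    unfolding achieved_service_def
  proof (rule Limsup_bounded)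
    obtain T\<^sub>0 where T\<^sub>0: "\<And>T. T \<ge> T\<^sub>0 \<Longrightarrow> representable M P T (nat \<lceil>(r + \<epsilon>) * T\<rceil>)"
      using assms(5)[OF \<open>\<epsilon> > 0\<close>] by blast
    have "(\<integral>\<^sup>+ D. expected_service M D (execution M P D T) \<partial>measure_pmf (law M)) / ennreal T
        \<le> ennreal (r + 2 * \<epsilon>) * capacity_inf M" if T: "T \<ge> max T\<^sub>0 (1 / \<epsilon>)" for T
    proof -
      have "0 < 1 / \<epsilon>" using \<open>\<epsilon> > 0\<close> by simp
      then have "T > 0" using T by linarith
      \<comment> \<open>The threshold \<open>1 / \<epsilon>\<close> is chosen for this: the 1 added
        by the ceiling is at most \<open>\<epsilon> * T\<close>.\<close>
      have "1 \<le> \<epsilon> * T" using T \<open>\<epsilon> > 0\<close> by (simp add: field_simps)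
      moreover have "real (nat \<lceil>(r + \<epsilon>) * T\<rceil>) \<le> (r + \<epsilon>) * T + 1"
        using \<open>T > 0\<close> \<open>\<epsilon> > 0\<close> \<open>r > 0\<close> by (simp add: of_nat_nat)
      ultimately have "real (nat \<lceil>(r + \<epsilon>) * T\<rceil>) \<le> (r + 2 * \<epsilon>) * T" by (simp add: algebra_simps)
      then have W: "of_nat (nat \<lceil>(r + \<epsilon>) * T\<rceil>) \<le> ennreal ((r + 2 * \<epsilon>) * T)"
        unfolding ennreal_of_nat_eq_real_of_nat by (rule ennreal_leI)
      have "(\<integral>\<^sup>+ D. expected_service M D (execution M P D T) \<partial>measure_pmf (law M))
          \<le> of_nat (nat \<lceil>(r + \<epsilon>) * T\<rceil>) * capacity_inf M"
        using T by (intro expected_service_representable_le[OF fin] T\<^sub>0) simp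
      also have "\<dots> \<le> ennreal ((r + 2 * \<epsilon>) * T) * capacity_inf M"
        by (rule mult_right_mono[OF W]) simp
      also have "\<dots> = (ennreal (r + 2 * \<epsilon>) * capacity_inf M) * ennreal T"
        using \<open>T > 0\<close> \<open>\<epsilon> > 0\<close> \<open>r > 0\<close> by (simp add: ennreal_mult mult_ac)
      finally have "(\<integral>\<^sup>+ D. expected_service M D (execution M P D T) \<partial>measure_pmf (law M)) / ennreal T
          \<le> (ennreal (r + 2 * \<epsilon>) * capacity_inf M) * ennreal T / ennreal T"
        by (rule divide_right_mono_ennreal)
      also have "\<dots> = ennreal (r + 2 * \<epsilon>) * capacity_inf M"
        using \<open>T > 0\<close> by (simp add: ennreal_mult_divide_eq)
      finally show ?thesis .
    qed
    then show "\<forall>\<^sub>F T in at_top. (\<integral>\<^sup>+ D. expected_service M D (execution M P D T) \<partial>measure_pmf (law M))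
        / ennreal T \<le> ennreal (r + 2 * \<epsilon>) * capacity_inf M"
      unfolding eventually_at_top_linorder by blast
  qed
  show ?thesis
  proof (cases "capacity_inf M")
    \<comment> \<open>In \<open>ennreal\<close> the product of 0 and \<open>top\<close> is 0, so
      \<open>r > 0\<close> is what makes the right-hand side infinite here.\<close>
    case top
    then show ?thesis using \<open>r > 0\<close> by (simp add: ennreal_mult_top)
  next
    case (real c)
    show ?thesis
    proof (rule ennreal_le_epsilon)
      fix e :: real assume "e > 0"
      \<comment> \<open>Chosen so that the surplus \<open>2 * \<epsilon> * c\<close> is at most
        \<open>e\<close>; \<open>c + 1\<close> keeps the denominator positive when
        \<open>c = 0\<close>.\<close>
      define \<epsilon> where "\<epsilon> = e / (2 * (c + 1))"
      have "\<epsilon> > 0" using \<open>e > 0\<close> real by (simp add: \<epsilon>_def)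
      have "2 * \<epsilon> * c \<le> 2 * \<epsilon> * (c + 1)" using \<open>\<epsilon> > 0\<close> by simp
      also have "\<dots> = e" using real by (simp add: \<epsilon>_def field_simps)
      finally have le: "(r + 2 * \<epsilon>) * c \<le> r * c + e" by (simp add: algebra_simps)
      have "achieved_service M P \<le> ennreal ((r + 2 * \<epsilon>) * c)"
        using bound[OF \<open>\<epsilon> > 0\<close>] real \<open>\<epsilon> > 0\<close> \<open>r > 0\<close> by (simp add: ennreal_mult)
      also have "\<dots> \<le> ennreal (r * c + e)" using le by (rule ennreal_leI)
      also have "\<dots> = ennreal r * capacity_inf M + ennreal e"
        using real \<open>e > 0\<close> \<open>r > 0\<close> by (simp add: ennreal_mult)
      finally show "achieved_service M P \<le> ennreal r * capacity_inf M + ennreal e" .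
    qed
  qed
qed

end
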